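(* Let $T$ be a (non-degenerate) triangle in the plane with vertices $A,B,C$, and let $P_1=(x_1,y_1)$ and $P_2=(x_2,y_2)$ be distinct points lying in the interior of $T$. (i) Suppose that $P_1$ and $P_2$ do not lie on the same line through any of the vertices of $T$ (that is, the line through $P_1$ and $P_2$ contains none of $A,B,C$). Then there are precisely four distinct ellipses inscribed in $T$ which pass through $P_1$ and $P_2$. (ii) Suppose that $P_1$ and $P_2$ do lie on the same line through one of the vertices of $T$. Then there are precisely two distinct ellipses inscribed in $T$ which pass through $P_1$ and $P_2$.
   Context: An ellipse (circles included) is inscribed in the triangle $T$ if it lies in $T$ (the closed triangular region) and is tangent to each side of $T$. *)

theory Defs
  imports "HOL-Analysis.Analysis"
begin

text \<open>An ellipse is the boundary curve (not the filled region) with centre \<open>c\<close> and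
  orthogonal semi-axis vectors \<open>u\<close>, \<open>v\<close>; it is a circle if \<open>norm u = norm v\<close>.\<close>

definition is_ellipse :: "(real^2) set \<Rightarrow> bool" where
  "is_ellipse E \<longleftrightarrow>
     (\<exists>c u v. u \<noteq> 0 \<and> v \<noteq> 0 \<and> u \<bullet> v = 0 \<and>
        E = {c + cos t *\<^sub>R u + sin t *\<^sub>R v | t. True})"

text \<open>\<open>L\<close> is the line through \<open>p\<close> spanned by the velocity \<open>d\<close> of a curve that runs
  inside \<open>E\<close> and is at \<open>p\<close> at time \<open>0\<close> with non-zero velocity. For an ellipse the line so
  obtained at a given point is unique.\<close>

definition tangent_line_at :: "(real^2) set \<Rightarrow> real^2 \<Rightarrow> (real^2) set \<Rightarrow> bool" where
  "tangent_line_at E p L \<longleftrightarrow>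
     (\<exists>g d. (\<forall>s::real. g s \<in> E) \<and> g 0 = p \<and> (g has_vector_derivative d) (at 0) \<and>
        d \<noteq> 0 \<and> L = {p + r *\<^sub>R d | r. True})"

text \<open>The point of tangency is required to lie on the side itself, not merely on its
  extension.\<close>

definition tangent_to_side :: "(real^2) set \<Rightarrow> real^2 \<Rightarrow> real^2 \<Rightarrow> bool" where
  "tangent_to_side E A B \<longleftrightarrow>
     (\<exists>p \<in> closed_segment A B. tangent_line_at E p (affine hull {A, B}))"

definition inscribed_ellipse :: "real^2 \<Rightarrow> real^2 \<Rightarrow> real^2 \<Rightarrow> (real^2) set \<Rightarrow> bool" where
  "inscribed_ellipse A B C E \<longleftrightarrow>
     is_ellipse E \<and> E \<subseteq> convex hull {A, B, C} \<and>
     tangent_to_side E A B \<and> tangent_to_side E B C \<and> tangent_to_side E C A"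

end

(* In barycentric coordinates the inscribed ellipses are the conics
   sqrt (l x) +- sqrt (m y) +- sqrt (n z) = 0 with weights l, m, n > 0, unique up to scaling.
   With square roots of weights and coordinates as new variables, passing through an interior
   point means that one of the three products is the sum of the other two: three linear
   equations, exactly one of which holds for a given ellipse. For two points (a1,b1,c1) and
   (a2,b2,c2) this gives nine pairs of equations, each with at most one positive solution up to
   scaling, namely the cross product of the coefficient vectors if it has constant sign. Let
   (u,v,w) be the cross product of the points. Two different equation types contribute one
   solution per nonzero entry of (u,v,w), in total; equal types contribute one solution if no
   entry vanishes and none otherwise, as u, v, w satisfy a linear relation with positive
   coefficients. An entry vanishes iff the line through the points meets the corresponding
   vertex, and at most one does. *)

theory Submission
  imports Defs
begin

section \<open>The planar cross product and collinearity\<close>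

definition cr :: "real^2 \<Rightarrow> real^2 \<Rightarrow> real" where
  "cr u v = u$1 * v$2 - u$2 * v$1"

lemma cr_add: "cr (u + v) w = cr u w + cr v w" "cr w (u + v) = cr w u + cr w v"
  and cr_diff: "cr (u - v) w = cr u w - cr v w" "cr w (u - v) = cr w u - cr w v"
  and cr_scale: "cr (k *\<^sub>R u) w = k * cr u w" "cr w (k *\<^sub>R u) = k * cr w u"
  and cr_self [simp]: "cr u u = 0" "cr 0 u = 0" "cr u 0 = 0"
  by (simp_all add: cr_def algebra_simps)

lemma cr_swap: "cr u v = - cr v u"
  by (simp add: cr_def)

text \<open>Cramer's rule with the denominator cleared; it holds for dependent \<open>u\<close> and
  \<open>v\<close> as well.\<close>

lemma cr_expand: "cr u v *\<^sub>R w = cr w v *\<^sub>R u + cr u w *\<^sub>R v"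
  unfolding cr_def vec_eq_iff forall_2 by (simp add: algebra_simps)

lemma cr_basis:
  assumes "cr u v \<noteq> 0"
  shows "w = (cr w v / cr u v) *\<^sub>R u + (cr u w / cr u v) *\<^sub>R v"
proof -
  have "w = (1 / cr u v) *\<^sub>R (cr u v *\<^sub>R w)" using assms by simp
  also have "\<dots> = (cr w v / cr u v) *\<^sub>R u + (cr u w / cr u v) *\<^sub>R v"
    unfolding cr_expand[of u v w] by (simp add: scaleR_add_right)
  finally show ?thesis .
qed

lemma collinear_iff_cr: "collinear {A, B, C} \<longleftrightarrow> cr (A - C) (B - C) = 0"
proof -
  have "collinear {A, B, C} \<longleftrightarrow> collinear {A, C, B}" by (simp only: insert_commute[of C B])
  also have "\<dots> \<longleftrightarrow> collinear {0, A - C, B - C}"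
    using collinear_3[of A C B] unfolding NO_MATCH_def by blast
  also have "\<dots> \<longleftrightarrow> A - C = 0 \<or> B - C = 0 \<or> (\<exists>k. B - C = k *\<^sub>R (A - C))"
    by (rule collinear_lemma)
  also have "\<dots> \<longleftrightarrow> cr (A - C) (B - C) = 0"
  proof
    assume "A - C = 0 \<or> B - C = 0 \<or> (\<exists>k. B - C = k *\<^sub>R (A - C))"
    then show "cr (A - C) (B - C) = 0" by (auto simp only: cr_scale cr_self mult_zero_right)
  next
    assume *: "cr (A - C) (B - C) = 0"
    show "A - C = 0 \<or> B - C = 0 \<or> (\<exists>k. B - C = k *\<^sub>R (A - C))"
    proof (cases "A - C = 0")
      case False
      then have "A - C = 0 \<or> (A - C)$1 \<noteq> 0 \<or> (A - C)$2 \<noteq> 0"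
        unfolding vec_eq_iff forall_2 zero_index by blast
      \<comment> \<open>The factor is read off from whichever coordinate of \<open>A - C\<close> is
        non-zero.\<close>
      with False have "B - C = ((B - C)$1 / (A - C)$1) *\<^sub>R (A - C)
          \<or> B - C = ((B - C)$2 / (A - C)$2) *\<^sub>R (A - C)"
        using * unfolding vec_eq_iff forall_2 cr_def
        by (auto simp add: nonzero_eq_divide_eq mult.commute simp del: vector_minus_component)
      then show ?thesis by blast
    qed blast
  qed
  finally show ?thesis .
qed

section \<open>Ellipses as affine images of the unit circle\<close>

text \<open>Here \<open>u\<close> and \<open>v\<close> are conjugate semi-diameters and need not be
  orthogonal. This form survives affine maps, so it can be read in barycentric coordinates.\<close>

definition ellipse_param :: "real^2 \<Rightarrow> real^2 \<Rightarrow> real^2 \<Rightarrow> (real^2) set" where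
  "ellipse_param c u v = {c + a *\<^sub>R u + b *\<^sub>R v | a b. a\<^sup>2 + b\<^sup>2 = 1}"

lemma ellipse_param_trig:
  "ellipse_param c u v = {c + cos t *\<^sub>R u + sin t *\<^sub>R v | t. True}"
  unfolding ellipse_param_def
  by (auto; metis sincos_total_2pi sin_cos_squared_add2)

text \<open>Rotating the parameter \<open>(a, b)\<close> by the angle with cosine \<open>k\<close>
  and sine \<open>h\<close> maps the unit circle onto itself and only changes the conjugate
  pair.\<close>

lemma ellipse_param_rotate:
  assumes "k\<^sup>2 + h\<^sup>2 = 1"
  shows "ellipse_param c (k *\<^sub>R u + h *\<^sub>R v) (k *\<^sub>R v - h *\<^sub>R u) = ellipse_param c u v"
proof -
  have "a *\<^sub>R (k *\<^sub>R u + h *\<^sub>R v) + b *\<^sub>R (k *\<^sub>R v - h *\<^sub>R u)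
      = (a * k - b * h) *\<^sub>R u + (a * h + b * k) *\<^sub>R v" for a b
    by (simp add: algebra_simps)
  moreover have "(a * k - b * h)\<^sup>2 + (a * h + b * k)\<^sup>2 = (a\<^sup>2 + b\<^sup>2) * (k\<^sup>2 + h\<^sup>2)" for a b
    by (simp add: power2_eq_square algebra_simps)
  moreover have "((a * k + b * h) * k - (b * k - a * h) * h) = a * (k\<^sup>2 + h\<^sup>2)"
    "((a * k + b * h) * h + (b * k - a * h) * k) = b * (k\<^sup>2 + h\<^sup>2)"
    "(a * k + b * h)\<^sup>2 + (b * k - a * h)\<^sup>2 = (a\<^sup>2 + b\<^sup>2) * (k\<^sup>2 + h\<^sup>2)" for a b
    by (simp_all add: power2_eq_square algebra_simps)
  ultimately show ?thesis
    unfolding ellipse_param_def add.assoc using assms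
    by (auto; metis mult_1_right)
qed

text \<open>Principal axes are found by continuity: a quarter turn of the parameter negates the
  inner product \<open>f t\<close> of the conjugate pair, so some rotation in between makes the pair
  orthogonal.\<close>

lemma is_ellipse_iff: "is_ellipse E \<longleftrightarrow> (\<exists>c u v. cr u v \<noteq> 0 \<and> E = ellipse_param c u v)"
proof
  assume "is_ellipse E"
  then obtain c u v where uv: "u \<noteq> 0" "v \<noteq> 0" "u \<bullet> v = 0" and E: "E = ellipse_param c u v"
    unfolding is_ellipse_def ellipse_param_trig by blast
  have "(cr u v)\<^sup>2 + (u \<bullet> v)\<^sup>2 = (u \<bullet> u) * (v \<bullet> v)"
    by (simp add: cr_def inner_vec_def sum_2 power2_eq_square algebra_simps)
  with uv have "cr u v \<noteq> 0" by auto
  with E show "\<exists>c u v. cr u v \<noteq> 0 \<and> E = ellipse_param c u v" by blast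
next
  assume "\<exists>c u v. cr u v \<noteq> 0 \<and> E = ellipse_param c u v"
  then obtain c u v where uv: "cr u v \<noteq> 0" and E: "E = ellipse_param c u v" by blast
  define f where "f t = (cos t *\<^sub>R u + sin t *\<^sub>R v) \<bullet> (cos t *\<^sub>R v - sin t *\<^sub>R u)" for t
  have cont: "continuous_on S f" for S unfolding f_def by (intro continuous_intros)
  have f0: "f 0 = u \<bullet> v" "f (pi/2) = - (u \<bullet> v)"
    by (simp_all add: f_def inner_commute)
  have "\<exists>t. f t = 0"
  proof (cases "u \<bullet> v \<le> 0")
    case True
    then show ?thesis using IVT'[of f 0 0 "pi/2"] f0 cont by force
  next
    case False
    then show ?thesis using IVT2'[of f "pi/2" 0 0] f0 cont by force
  qed
  then obtain t where t: "f t = 0" ..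
  define k h where "k = cos t" and "h = sin t"
  have kh: "k\<^sup>2 + h\<^sup>2 = 1" by (simp add: k_def h_def)
  define u' v' where "u' = k *\<^sub>R u + h *\<^sub>R v" and "v' = k *\<^sub>R v - h *\<^sub>R u"
  have "cr u' v' = (k\<^sup>2 + h\<^sup>2) * cr u v"
    unfolding u'_def v'_def
    by (simp add: cr_add cr_diff cr_scale power2_eq_square algebra_simps cr_swap[of v u])
  then have "u' \<noteq> 0" "v' \<noteq> 0" using uv kh by auto
  moreover have "u' \<bullet> v' = 0" using t by (simp add: f_def u'_def v'_def k_def h_def)
  moreover have "E = ellipse_param c u' v'"
    unfolding E u'_def v'_def using ellipse_param_rotate[OF kh] by simp
  ultimately show "is_ellipse E" unfolding is_ellipse_def ellipse_param_trig by blast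
qed

text \<open>The vector \<open>a *\<^sub>R v - b *\<^sub>R u\<close> is the velocity at the parameter
  \<open>(a, b)\<close> when the unit circle is traversed at unit speed, so the last hypothesis says
  that the curve runs along the side there.\<close>

lemma tangent_to_sideI:
  assumes "cr u v \<noteq> 0" "a\<^sup>2 + b\<^sup>2 = 1" "c + a *\<^sub>R u + b *\<^sub>R v \<in> closed_segment P R"
    and k: "a *\<^sub>R v - b *\<^sub>R u = k *\<^sub>R (R - P)"
  shows "tangent_to_side (ellipse_param c u v) P R"
proof -
  define p where "p = c + a *\<^sub>R u + b *\<^sub>R v"
  define d where "d = a *\<^sub>R v - b *\<^sub>R u"
  \<comment> \<open>The parameter \<open>(a, b)\<close> is rotated by the angle
    \<open>s\<close>.\<close>
  define g where "g s = c + (a * cos s - b * sin s) *\<^sub>R u + (b * cos s + a * sin s) *\<^sub>R v" for s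
  have gE: "g s \<in> ellipse_param c u v" for s
  proof -
    have "(a * cos s - b * sin s)\<^sup>2 + (b * cos s + a * sin s)\<^sup>2
        = (a\<^sup>2 + b\<^sup>2) * ((cos s)\<^sup>2 + (sin s)\<^sup>2)"
      by (simp add: power2_eq_square algebra_simps
          del: sin_cos_squared_add sin_cos_squared_add2 sin_cos_squared_add3)
    then show ?thesis unfolding g_def ellipse_param_def using assms(2) by fastforce
  qed
  have g0: "g 0 = p" by (simp add: g_def p_def)
  have der: "(g has_vector_derivative d) (at 0)"
    unfolding g_def d_def
    by (auto intro!: derivative_eq_intros simp: algebra_simps)
  \<comment> \<open>Both products would vanish for \<open>d = 0\<close>, but \<open>a\<close> and
    \<open>b\<close> are not both zero.\<close>
  have "cr u d = a * cr u v" "cr d v = - b * cr u v"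
    by (simp_all add: d_def cr_diff cr_scale)
  then have d0: "d \<noteq> 0" using assms(1,2) by auto
  then have k0: "k \<noteq> 0" and dk: "d = k *\<^sub>R (R - P)" using k by (auto simp: d_def)
  obtain t where t: "p = (1 - t) *\<^sub>R P + t *\<^sub>R R"
    using assms(3) by (auto simp: p_def closed_segment_def)
  have "affine hull {P, R} = {p + r *\<^sub>R d | r. True}"
  proof (intro set_eqI iffI)
    fix q assume "q \<in> affine hull {P, R}"
    then obtain s s' where "q = s *\<^sub>R P + s' *\<^sub>R R" "s + s' = 1" by (auto simp: affine_hull_2)
    then have s: "s = 1 - s'" and q: "q = s *\<^sub>R P + s' *\<^sub>R R" by auto
    have "q = p + (s' - t) *\<^sub>R (R - P)"
      unfolding t q s by (simp add: algebra_simps)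
    also have "\<dots> = p + ((s' - t) / k) *\<^sub>R d" unfolding dk using k0 by simp
    finally show "q \<in> {p + r *\<^sub>R d | r. True}" by blast
  next
    fix q assume "q \<in> {p + r *\<^sub>R d | r. True}"
    then obtain r where "q = p + r *\<^sub>R d" by blast
    then have "q = (1 - (t + r * k)) *\<^sub>R P + (t + r * k) *\<^sub>R R"
      unfolding t dk by (simp add: algebra_simps)
    then show "q \<in> affine hull {P, R}" unfolding affine_hull_2
      by (smt (verit) mem_Collect_eq)
  qed
  then have "tangent_line_at (ellipse_param c u v) p (affine hull {P, R})"
    unfolding tangent_line_at_def using gE g0 der d0 by blast
  then show ?thesis unfolding tangent_to_side_def using assms(3) p_def by blast
qed

section \<open>Affine functions touching zero on the unit circle\<close>

text \<open>The minimum on the circle is \<open>r\<close> minus the norm of \<open>(d, e)\<close>. A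
  zero of a non-negative function attains the minimum, so \<open>r\<close> equals that norm and the
  derivative \<open>a * e - b * d\<close> along the circle vanishes. Applied to a barycentric
  coordinate on an ellipse, this expresses tangency to a side.\<close>

lemma unit_circle_tangent:
  fixes r d e :: real
  assumes nonneg: "\<And>a b. a\<^sup>2 + b\<^sup>2 = 1 \<Longrightarrow> 0 \<le> r + a * d + b * e"
    and ab: "a\<^sup>2 + b\<^sup>2 = 1" and zero: "r + a * d + b * e = 0"
  shows "0 \<le> r" "d\<^sup>2 + e\<^sup>2 = r\<^sup>2" "a * e - b * d = 0"
proof -
  \<comment> \<open>At the antipodal point the value is \<open>2 * r\<close>.\<close>
  show r: "0 \<le> r" using nonneg[of "-a" "-b"] ab zero by simp
  have lagrange: "(a * d + b * e)\<^sup>2 + (a * e - b * d)\<^sup>2 = (a\<^sup>2 + b\<^sup>2) * (d\<^sup>2 + e\<^sup>2)"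
    by (simp add: power2_eq_square algebra_simps)
  have r2: "r\<^sup>2 + (a * e - b * d)\<^sup>2 = d\<^sup>2 + e\<^sup>2"
  proof -
    have "a * d + b * e = - r" using zero by simp
    then show ?thesis using lagrange ab by simp
  qed
  have "d\<^sup>2 + e\<^sup>2 \<le> r\<^sup>2"
  proof (cases "d\<^sup>2 + e\<^sup>2 = 0")
    case False
    define N where "N = sqrt (d\<^sup>2 + e\<^sup>2)"
    have N: "N > 0" "N\<^sup>2 = d\<^sup>2 + e\<^sup>2" using False by (auto simp: N_def sum_power2_gt_zero_iff)
    \<comment> \<open>The point of the circle opposite to the direction \<open>(d, e)\<close>, where
      the minimum \<open>r - N\<close> is attained.\<close>
    have "(- d / N)\<^sup>2 + (- e / N)\<^sup>2 = 1"
      using N False by (simp add: power_divide add_divide_distrib[symmetric])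
    then have "0 \<le> r + (- d / N) * d + (- e / N) * e" by (rule nonneg)
    also have "\<dots> = r - (d\<^sup>2 + e\<^sup>2) / N" by (simp add: power2_eq_square add_divide_distrib)
    also have "\<dots> = r - N" unfolding N(2)[symmetric] using N(1) by (simp add: power2_eq_square)
    finally have "N \<le> r" by simp
    then show ?thesis using N by (metis less_imp_le power_mono)
  qed simp
  with r2 have "(a * e - b * d)\<^sup>2 \<le> 0" by linarith
  then show *: "a * e - b * d = 0" by simp
  with r2 show "d\<^sup>2 + e\<^sup>2 = r\<^sup>2" by simp
qed

section \<open>The quadratic form of a conic touching the three side lines\<close>

text \<open>In barycentric coordinates \<open>x\<close>, \<open>y\<close>, \<open>z\<close> this is the conic
  \<open>\<plusminus> sqrt (l x) \<plusminus> sqrt (m y) \<plusminus> sqrt (n z) = 0\<close> with the radicals cleared.\<close>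

definition Q :: "real \<Rightarrow> real \<Rightarrow> real \<Rightarrow> real \<Rightarrow> real \<Rightarrow> real \<Rightarrow> real" where
  "Q l m n x y z = l\<^sup>2 * x\<^sup>2 + m\<^sup>2 * y\<^sup>2 + n\<^sup>2 * z\<^sup>2
     - 2 * l * m * x * y - 2 * m * n * y * z - 2 * l * n * x * z"

lemma Q_scale: "Q (k * l) (k * m) (k * n) x y z = k\<^sup>2 * Q l m n x y z"
  by (simp add: Q_def power2_eq_square algebra_simps)

lemma Q_complete_square:
  "Q l m n x y z = (l * x + m * y - n * z)\<^sup>2 - 4 * l * m * x * y"
  by (simp add: Q_def power2_eq_square algebra_simps)

lemma pos_nonneg_mult: "0 < a \<Longrightarrow> 0 \<le> a * b \<longleftrightarrow> 0 \<le> b" for a b :: real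
  by (simp add: zero_le_mult_iff)

text \<open>Completing the square in three ways shows that on the conic the pairwise products of the
  coordinates are non-negative; coordinates with sum 1 are then non-negative themselves. This keeps
  the conic inside the triangle.\<close>

lemma Q_zero_nonneg:
  assumes "0 < l" "0 < m" "0 < n" "x + y + z = 1" "Q l m n x y z = 0"
  shows "0 \<le> x" "0 \<le> y" "0 \<le> z"
proof -
  have "4 * (l * m) * (x * y) = (l * x + m * y - n * z)\<^sup>2"
    "4 * (m * n) * (y * z) = (m * y + n * z - l * x)\<^sup>2"
    "4 * (l * n) * (x * z) = (l * x + n * z - m * y)\<^sup>2"
    using assms(5) by (simp_all add: Q_def power2_eq_square algebra_simps)
  then have "0 \<le> 4 * (l * m) * (x * y)" "0 \<le> 4 * (m * n) * (y * z)" "0 \<le> 4 * (l * n) * (x * z)"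
    by simp_all
  then have "0 \<le> x * y" "0 \<le> y * z" "0 \<le> x * z"
    using assms(1-3) by (simp_all add: pos_nonneg_mult)
  then show "0 \<le> x" "0 \<le> y" "0 \<le> z" using assms(4)
    by (auto simp: zero_le_mult_iff)
qed

text \<open>If \<open>r\<^sub>i + a d\<^sub>i + b e\<^sub>i\<close> are the barycentric coordinates of the point with parameter
  \<open>(a, b)\<close>, the hypotheses \<open>d\<^sub>i\<^sup>2 + e\<^sub>i\<^sup>2 = r\<^sub>i\<^sup>2\<close> say that the image of the unit circle touches
  the three side lines. So the centre determines the weights of the conic.\<close>

lemma Q_on_ellipse:
  fixes r1 r2 r3 d1 d2 d3 e1 e2 e3 :: real
  assumes r: "r1 + r2 + r3 = 1" and s: "d1 + d2 + d3 = 0" "e1 + e2 + e3 = 0"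
    and n: "d1\<^sup>2 + e1\<^sup>2 = r1\<^sup>2" "d2\<^sup>2 + e2\<^sup>2 = r2\<^sup>2" "d3\<^sup>2 + e3\<^sup>2 = r3\<^sup>2"
  defines "\<delta> \<equiv> d1 * e2 - e1 * d2"
  shows "(1 - 2 * r1) * (1 - 2 * r2) * (1 - 2 * r3) = 4 * \<delta>\<^sup>2"
    and "Q (1 - 2 * r1) (1 - 2 * r2) (1 - 2 * r3)
          (r1 + a * d1 + b * e1) (r2 + a * d2 + b * e2) (r3 + a * d3 + b * e3)
         = 4 * \<delta>\<^sup>2 * (a\<^sup>2 + b\<^sup>2 - 1)"
proof -
  \<comment> \<open>The vectors \<open>(d1, e1)\<close> and \<open>(d2, e2)\<close> have inner
    product \<open>w\<close> and determinant \<delta>. As the three vectors sum to zero, the law of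
    cosines gives \<open>w\<close>, and Lagrange's identity then gives \<delta>.\<close>
  define w where "w = d1 * d2 + e1 * e2"
  define l m n where "l = 1 - 2 * r1" and "m = 1 - 2 * r2" and "n = 1 - 2 * r3"
  note lmn = l_def[symmetric] m_def[symmetric] n_def[symmetric]
  have r3: "r3 = 1 - r1 - r2" and d3: "d3 = - d1 - d2" and e3: "e3 = - e1 - e2"
    using r s by linarith+
  have lm: "l * m + n = 4 * r1 * r2" and ln: "l + n = 2 * r2" and mn: "m + n = 2 * r1"
    unfolding l_def m_def n_def r3 by (simp_all add: algebra_simps)
  have "2 * w = r3\<^sup>2 - r1\<^sup>2 - r2\<^sup>2"
    using n unfolding d3 e3 w_def by (simp add: power2_eq_square algebra_simps)
  then have w: "4 * w = l * m - n"
    unfolding l_def m_def n_def r3 by (simp add: power2_eq_square algebra_simps)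
  have \<delta>: "\<delta>\<^sup>2 = r1\<^sup>2 * r2\<^sup>2 - w\<^sup>2"
    unfolding n(1,2)[symmetric] w_def \<delta>_def by (simp add: power2_eq_square algebra_simps)
  have "16 * \<delta>\<^sup>2 = (4 * r1 * r2)\<^sup>2 - (4 * w)\<^sup>2" unfolding \<delta> by (simp add: power_mult_distrib)
  also have "\<dots> = 4 * (l * m * n)"
    unfolding w lm[symmetric] by (simp add: power2_eq_square algebra_simps)
  finally have L: "l * m * n = 4 * \<delta>\<^sup>2" by simp
  then show "(1 - 2 * r1) * (1 - 2 * r2) * (1 - 2 * r3) = 4 * \<delta>\<^sup>2" unfolding lmn .
  define f g where "f = a * d1 + b * e1" and "g = a * d2 + b * e2"
  have h: "r1 + a * d1 + b * e1 = r1 + f" "r2 + a * d2 + b * e2 = r2 + g"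
     "r3 + a * d3 + b * e3 = r3 - f - g"
    unfolding f_def g_def d3 e3 by (simp_all add: algebra_simps)
  have "l * (r1 + f) + m * (r2 + g) - n * (r3 - f - g)
      = (l * r1 + m * r2 - n * r3) + (l + n) * f + (m + n) * g"
    by (simp add: algebra_simps)
  also have "l * r1 + m * r2 - n * r3 = l * m"
    unfolding l_def m_def n_def r3 by (simp add: algebra_simps)
  finally have k: "l * (r1 + f) + m * (r2 + g) - n * (r3 - f - g) = l * m + 2 * r2 * f + 2 * r1 * g"
    unfolding ln mn .
  have "Q l m n (r1 + f) (r2 + g) (r3 - f - g)
      = (l * (r1 + f) + m * (r2 + g) - n * (r3 - f - g))\<^sup>2 - 4 * l * m * (r1 + f) * (r2 + g)"
    by (rule Q_complete_square)
  \<comment> \<open>The terms linear in \<open>f\<close> and \<open>g\<close> cancel because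
    \<open>(r1, r2, r3)\<close> is the centre of the conic.\<close>
  also have "\<dots> = 4 * (r2\<^sup>2 * f\<^sup>2 + r1\<^sup>2 * g\<^sup>2) + (2 * (4 * r1 * r2) - 4 * (l * m)) * f * g
      - l * m * (4 * r1 * r2 - l * m)"
    unfolding k by (simp add: power2_eq_square algebra_simps)
  also have "\<dots> = 4 * (r2\<^sup>2 * f\<^sup>2 + r1\<^sup>2 * g\<^sup>2) - 2 * (l * m - n) * f * g - l * m * n"
    unfolding lm[symmetric] by (simp add: algebra_simps)
  also have "\<dots> = 4 * (r2\<^sup>2 * f\<^sup>2 + r1\<^sup>2 * g\<^sup>2 - 2 * w * f * g) - 4 * \<delta>\<^sup>2"
    unfolding w[symmetric] L by simp
  \<comment> \<open>The left side is the squared norm of \<open>f\<close> times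
    \<open>(d2, e2)\<close> minus \<open>g\<close> times \<open>(d1, e1)\<close>, which is \<delta>
    times the vector \<open>(- b, a)\<close>.\<close>
  also have "r2\<^sup>2 * f\<^sup>2 + r1\<^sup>2 * g\<^sup>2 - 2 * w * f * g = \<delta>\<^sup>2 * (a\<^sup>2 + b\<^sup>2)"
    unfolding n(1,2)[symmetric] w_def f_def g_def \<delta>_def
    by (simp add: power2_eq_square algebra_simps)
  finally show "Q (1 - 2 * r1) (1 - 2 * r2) (1 - 2 * r3)
          (r1 + a * d1 + b * e1) (r2 + a * d2 + b * e2) (r3 + a * d3 + b * e3)
         = 4 * \<delta>\<^sup>2 * (a\<^sup>2 + b\<^sup>2 - 1)"
    unfolding h lmn by (simp add: algebra_simps)
qed

text \<open>The triangle inequality for vectors \<open>(d1, e1)\<close>, \<open>(d2, e2)\<close>,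
  \<open>(d3, e3)\<close> of lengths \<open>r1\<close>, \<open>r2\<close>, \<open>r3\<close>. When
  the lengths sum to 1 it makes the weight \<open>1 - 2 * r1\<close> non-negative.\<close>

lemma norm_triangle_if_sum_zero:
  fixes r1 r2 r3 :: real
  assumes "d1 + d2 + d3 = 0" "e1 + e2 + e3 = 0" "0 \<le> r1" "0 \<le> r2" "0 \<le> r3"
    and "d1\<^sup>2 + e1\<^sup>2 = r1\<^sup>2" "d2\<^sup>2 + e2\<^sup>2 = r2\<^sup>2" "d3\<^sup>2 + e3\<^sup>2 = r3\<^sup>2"
  shows "r1 \<le> r2 + r3"
proof -
  have d: "d1 = - (d2 + d3)" "e1 = - (e2 + e3)" using assms(1,2) by linarith+
  have "r1 = sqrt (r1\<^sup>2)" using assms(3) by simp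
  also have "\<dots> = sqrt ((d2 + d3)\<^sup>2 + (e2 + e3)\<^sup>2)"
    unfolding assms(6)[symmetric] d power2_minus ..
  also have "\<dots> \<le> sqrt (d2\<^sup>2 + e2\<^sup>2) + sqrt (d3\<^sup>2 + e3\<^sup>2)" by (rule real_sqrt_sum_squares_triangle_ineq)
  also have "\<dots> = r2 + r3" using assms by simp
  finally show ?thesis .
qed

text \<open>Two coordinates along the line through two points are affine functions of
  \<open>u\<close>, not both constant. A common zero makes the determinant vanish since
  \<open>u\<close> and \<open>1 - u\<close> cannot both be zero; conversely the zero of a
  non-constant one serves. It is used to decide whether a line meets a vertex.\<close>

lemma common_zero_iff:
  fixes y1 y2 z1 z2 :: real
  assumes "\<not> (y1 = y2 \<and> z1 = z2)"
  shows "(\<exists>u. 0 = u * y1 + (1 - u) * y2 \<and> 0 = u * z1 + (1 - u) * z2) \<longleftrightarrow> y1 * z2 = z1 * y2"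
proof
  assume "\<exists>u. 0 = u * y1 + (1 - u) * y2 \<and> 0 = u * z1 + (1 - u) * z2"
  then obtain u where u: "u * y1 + (1 - u) * y2 = 0" "u * z1 + (1 - u) * z2 = 0" by auto
  have "u * (y1 * z2 - z1 * y2) = (u * y1 + (1 - u) * y2) * z2 - (u * z1 + (1 - u) * z2) * y2"
    "(1 - u) * (y1 * z2 - z1 * y2) = (u * z1 + (1 - u) * z2) * y1 - (u * y1 + (1 - u) * y2) * z1"
    by (simp_all add: algebra_simps)
  then have "u * (y1 * z2 - z1 * y2) = 0" "(1 - u) * (y1 * z2 - z1 * y2) = 0"
    unfolding u by simp_all
  then show "y1 * z2 = z1 * y2" by auto
next
  assume *: "y1 * z2 = z1 * y2"
  show "\<exists>u. 0 = u * y1 + (1 - u) * y2 \<and> 0 = u * z1 + (1 - u) * z2"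
  proof (cases "y1 = y2")
    case False
    with * show ?thesis by (intro exI[of _ "y2 / (y2 - y1)"]) (simp add: field_simps)
  next
    case True
    with assms have "z1 \<noteq> z2" by simp
    with * show ?thesis by (intro exI[of _ "z2 / (z2 - z1)"]) (simp add: field_simps)
  qed
qed

section \<open>Positive solutions of pairs of linear equations\<close>

text \<open>Solutions matter only up to scaling; the sum 1 selects one from each positive
  ray.\<close>

definition pos_sols :: "real \<Rightarrow> real \<Rightarrow> real \<Rightarrow> real \<Rightarrow> real \<Rightarrow> real \<Rightarrow> (real \<times> real \<times> real) set" where
  "pos_sols e1 e2 e3 f1 f2 f3 = {(l, m, n). 0 < l \<and> 0 < m \<and> 0 < n \<and> l + m + n = 1 \<and>
     e1 * l + e2 * m + e3 * n = 0 \<and> f1 * l + f2 * m + f3 * n = 0}"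

definition same_sign :: "real \<Rightarrow> real \<Rightarrow> real \<Rightarrow> bool" where
  "same_sign u v w \<longleftrightarrow> 0 < u \<and> 0 < v \<and> 0 < w \<or> u < 0 \<and> v < 0 \<and> w < 0"

text \<open>The solutions of the two equations form the line spanned by the cross product
  \<open>(u, v, w)\<close> of the coefficient vectors. It meets the open positive octant iff the
  entries have one common sign, and division by their sum normalises.\<close>

lemma pos_sols_eq:
  fixes e1 e2 e3 f1 f2 f3 :: real
  defines "u \<equiv> e2 * f3 - e3 * f2" and "v \<equiv> e3 * f1 - e1 * f3" and "w \<equiv> e1 * f2 - e2 * f1"
  assumes nz: "u \<noteq> 0 \<or> v \<noteq> 0 \<or> w \<noteq> 0"
  shows "pos_sols e1 e2 e3 f1 f2 f3 =
    (if same_sign u v w then {(u / (u + v + w), v / (u + v + w), w / (u + v + w))} else {})"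
proof -
  define s where "s = u + v + w"
  have 1: "same_sign u v w \<and> s \<noteq> 0 \<and> l = u / s \<and> m = v / s \<and> n = w / s"
    if "(l, m, n) \<in> pos_sols e1 e2 e3 f1 f2 f3" for l m n
  proof -
    have p: "0 < l" "0 < m" "0 < n" "l + m + n = 1"
      and E: "e1 * l + e2 * m + e3 * n = 0" and F: "f1 * l + f2 * m + f3 * n = 0"
      using that by (auto simp: pos_sols_def)
    \<comment> \<open>These are the minors of \<open>(u, v, w)\<close> against
      \<open>(l, m, n)\<close>; their vanishing makes the two triples proportional, with factor
      \<open>s\<close>.\<close>
    have "u * m - v * l = f3 * (e1 * l + e2 * m + e3 * n) - e3 * (f1 * l + f2 * m + f3 * n)"
      "v * n - w * m = f1 * (e1 * l + e2 * m + e3 * n) - e1 * (f1 * l + f2 * m + f3 * n)"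
      "w * l - u * n = f2 * (e1 * l + e2 * m + e3 * n) - e2 * (f1 * l + f2 * m + f3 * n)"
      by (simp_all add: u_def v_def w_def algebra_simps)
    then have c: "u * m = v * l" "v * n = w * m" "w * l = u * n" unfolding E F by simp_all
    have "u * (l + m + n) = s * l" "v * (l + m + n) = s * m" "w * (l + m + n) = s * n"
      using c by (simp_all add: s_def algebra_simps)
    then have d: "u = s * l" "v = s * m" "w = s * n" unfolding p(4) by simp_all
    then have "s \<noteq> 0" using nz by auto
    then show ?thesis using p unfolding d same_sign_def
      by (auto simp: zero_less_mult_iff mult_less_0_iff)
  qed
  have 2: "(u / s, v / s, w / s) \<in> pos_sols e1 e2 e3 f1 f2 f3" if ss: "same_sign u v w"
  proof -
    have p: "0 < u / s" "0 < v / s" "0 < w / s" and s: "s \<noteq> 0"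
      using ss by (auto simp: same_sign_def s_def zero_less_divide_iff)
    have "u / s + v / s + w / s = 1" using s by (simp add: s_def flip: add_divide_distrib)
    moreover have "e1 * u + e2 * v + e3 * w = 0" "f1 * u + f2 * v + f3 * w = 0"
      by (simp_all add: u_def v_def w_def algebra_simps)
    ultimately show ?thesis using p by (simp add: pos_sols_def flip: add_divide_distrib)
  qed
  show ?thesis unfolding s_def[symmetric] using 1 2 by (auto split: if_splits)
qed

lemma card_pos_sols:
  assumes "e2 * f3 - e3 * f2 \<noteq> 0 \<or> e3 * f1 - e1 * f3 \<noteq> 0 \<or> e1 * f2 - e2 * f1 \<noteq> 0"
  shows "finite (pos_sols e1 e2 e3 f1 f2 f3)"
    and "card (pos_sols e1 e2 e3 f1 f2 f3) =
      of_bool (same_sign (e2 * f3 - e3 * f2) (e3 * f1 - e1 * f3) (e1 * f2 - e2 * f1))"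
  unfolding pos_sols_eq[OF assms] by simp_all

text \<open>The factorisation behind Heron's formula, for side lengths \<open>a * l\<close>,
  \<open>b * m\<close>, \<open>c * n\<close>.\<close>

lemma Q_squares:
  "Q (l\<^sup>2) (m\<^sup>2) (n\<^sup>2) (a\<^sup>2) (b\<^sup>2) (c\<^sup>2) = - ((a * l + b * m + c * n) * (- (a * l) + b * m + c * n)
     * (a * l - b * m + c * n) * (a * l + b * m - c * n))"
proof -
  have "(p\<^sup>2 + q\<^sup>2 - r\<^sup>2)\<^sup>2 - 4 * p\<^sup>2 * q\<^sup>2 = - ((p + q + r) * (- p + q + r) * (p - q + r) * (p + q - r))"
    for p q r :: real
    by (simp add: power2_eq_square algebra_simps)
  from this[of "a * l" "b * m" "c * n"] show ?thesis
    unfolding Q_complete_square by (simp add: power_mult_distrib mult_ac)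
qed

text \<open>The weights of the conic are squared and the points are given by the square roots of their
  barycentric coordinates, so that passing through a point splits into linear equations.\<close>

definition inconic_params where
  "inconic_params a1 b1 c1 a2 b2 c2 = {(l, m, n). 0 < l \<and> 0 < m \<and> 0 < n \<and> l + m + n = 1 \<and>
     Q (l\<^sup>2) (m\<^sup>2) (n\<^sup>2) (a1\<^sup>2) (b1\<^sup>2) (c1\<^sup>2) = 0 \<and> Q (l\<^sup>2) (m\<^sup>2) (n\<^sup>2) (a2\<^sup>2) (b2\<^sup>2) (c2\<^sup>2) = 0}"

text \<open>The equation of type \<open>i\<close> makes the \<open>i\<close>-th product the sum of
  the other two; \<open>sg i k\<close> is the sign of its \<open>k\<close>-th term.\<close>

definition sg :: "nat \<Rightarrow> nat \<Rightarrow> real" where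
  "sg i k = (if i = k then - 1 else 1)"

text \<open>Of the four factors in \<open>Q_squares\<close> the one without minus signs is positive;
  the other three are the equation types.\<close>

lemma Q_squares_eq_0_iff:
  assumes "0 < a" "0 < b" "0 < c" "0 < l" "0 < m" "0 < n"
  shows "Q (l\<^sup>2) (m\<^sup>2) (n\<^sup>2) (a\<^sup>2) (b\<^sup>2) (c\<^sup>2) = 0 \<longleftrightarrow>
    (\<exists>i<3. sg i 0 * a * l + sg i 1 * b * m + sg i 2 * c * n = 0)"
proof -
  have *: "a * l + b * m + c * n \<noteq> 0" using assms by (intro less_imp_neq[symmetric] add_pos_pos mult_pos_pos)
  have "(\<exists>i<3. P i) \<longleftrightarrow> P 0 \<or> P 1 \<or> P 2" for P :: "nat \<Rightarrow> bool"
    by (auto simp: less_Suc_eq numeral_3_eq_3 numeral_2_eq_2)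
  then show ?thesis unfolding Q_squares mult_eq_0_iff neg_equal_0_iff_equal
    using * by (simp add: sg_def disj_assoc)
qed

text \<open>Adding two equations of different types leaves twice a positive term equal to
  zero.\<close>

lemma sg_unique:
  fixes p q r :: real
  assumes "0 < p" "0 < q" "0 < r" "i < 3" "j < 3"
    and "sg i 0 * p + sg i 1 * q + sg i 2 * r = 0" "sg j 0 * p + sg j 1 * q + sg j 2 * r = 0"
  shows "i = j"
proof -
  have "i = 0 \<or> i = 1 \<or> i = 2" "j = 0 \<or> j = 1 \<or> j = 2" using assms(4,5) by auto
  then show ?thesis using assms by (auto simp: sg_def)
qed

text \<open>Each of the two points contributes exactly one equation type, so the nine solution sets
  partition the parameters.\<close>

lemma card_inconic_params_eq_sum:
  fixes a1 b1 c1 a2 b2 c2 :: real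
  assumes pos: "0 < a1" "0 < b1" "0 < c1" "0 < a2" "0 < b2" "0 < c2"
  defines "S \<equiv> \<lambda>(i, j). pos_sols (sg i 0 * a1) (sg i 1 * b1) (sg i 2 * c1)
                            (sg j 0 * a2) (sg j 1 * b2) (sg j 2 * c2)"
  assumes fin: "\<And>i j. i < 3 \<Longrightarrow> j < 3 \<Longrightarrow> finite (S (i, j))"
  shows "card (inconic_params a1 b1 c1 a2 b2 c2) = (\<Sum>i<3. \<Sum>j<3. card (S (i, j)))"
proof -
  have "inconic_params a1 b1 c1 a2 b2 c2 = (\<Union>ij\<in>{..<3} \<times> {..<3}. S ij)"
  proof (intro set_eqI)
    fix q :: "real \<times> real \<times> real"
    obtain l m n where q: "q = (l, m, n)" by (metis prod_cases3)
    show "q \<in> inconic_params a1 b1 c1 a2 b2 c2 \<longleftrightarrow> q \<in> (\<Union>ij\<in>{..<3} \<times> {..<3}. S ij)"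
    proof (cases "0 < l \<and> 0 < m \<and> 0 < n")
      case True
      then have "q \<in> inconic_params a1 b1 c1 a2 b2 c2 \<longleftrightarrow> l + m + n = 1 \<and>
          (\<exists>i<3. sg i 0 * a1 * l + sg i 1 * b1 * m + sg i 2 * c1 * n = 0) \<and>
          (\<exists>j<3. sg j 0 * a2 * l + sg j 1 * b2 * m + sg j 2 * c2 * n = 0)"
        unfolding q inconic_params_def
        using Q_squares_eq_0_iff[of a1 b1 c1 l m n] Q_squares_eq_0_iff[of a2 b2 c2 l m n] pos by simp
      also have "\<dots> \<longleftrightarrow> (\<exists>i<3. \<exists>j<3. q \<in> S (i, j))"
        unfolding q S_def pos_sols_def prod.case mem_Collect_eq using True by blast
      also have "\<dots> \<longleftrightarrow> q \<in> (\<Union>ij\<in>{..<3} \<times> {..<3}. S ij)" by blast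
      finally show ?thesis .
    qed (auto simp: q S_def inconic_params_def pos_sols_def)
  qed
  also have "card \<dots> = (\<Sum>ij\<in>{..<3} \<times> {..<3}. card (S ij))"
  proof (rule card_UN_disjoint)
    show "\<forall>ij\<in>{..<3} \<times> {..<3}. finite (S ij)" using fin by auto
    show "\<forall>ij\<in>{..<3} \<times> {..<3}. \<forall>ij'\<in>{..<3} \<times> {..<3}. ij \<noteq> ij' \<longrightarrow> S ij \<inter> S ij' = {}"
    proof (intro ballI impI)
      fix ij ij' :: "nat \<times> nat"
      assume lt: "ij \<in> {..<3} \<times> {..<3}" "ij' \<in> {..<3} \<times> {..<3}" and neq: "ij \<noteq> ij'"
      have "ij = ij'" if "(l, m, n) \<in> S ij" "(l, m, n) \<in> S ij'" for l m n
        using sg_unique[of "a1 * l" "b1 * m" "c1 * n" "fst ij" "fst ij'"]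
          sg_unique[of "a2 * l" "b2 * m" "c2 * n" "snd ij" "snd ij'"] lt pos that
        by (simp add: S_def pos_sols_def mult.assoc mem_Times_iff prod_eq_iff case_prod_beta)
      with neq show "S ij \<inter> S ij' = {}" by auto
    qed
  qed simp
  finally show ?thesis by (simp add: sum.cartesian_product)
qed

lemma card_inconic_params:
  fixes a1 b1 c1 a2 b2 c2 :: real
  assumes pos: "0 < a1" "0 < b1" "0 < c1" "0 < a2" "0 < b2" "0 < c2"
    and nz: "\<not> (b1 * c2 = c1 * b2 \<and> c1 * a2 = a1 * c2 \<and> a1 * b2 = b1 * a2)"
  shows "card (inconic_params a1 b1 c1 a2 b2 c2) =
    (if b1 * c2 = c1 * b2 \<or> c1 * a2 = a1 * c2 \<or> a1 * b2 = b1 * a2 then 2 else 4)"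
proof -
  define u v w where "u = b1 * c2 - c1 * b2" and "v = c1 * a2 - a1 * c2" and "w = a1 * b2 - b1 * a2"
  define S where "S = (\<lambda>(i, j). pos_sols (sg i 0 * a1) (sg i 1 * b1) (sg i 2 * c1)
                            (sg j 0 * a2) (sg j 1 * b2) (sg j 2 * c2))"
  have prods: "0 < b1 * c2" "0 < c1 * b2" "0 < c1 * a2" "0 < a1 * c2" "0 < a1 * b2" "0 < b1 * a2"
    using pos by simp_all
  have rel: "a1 * u + b1 * v + c1 * w = 0" by (simp add: u_def v_def w_def algebra_simps)
  have three: "i = 0 \<or> i = 1 \<or> i = 2" if "i < 3" for i :: nat using that by auto
  note card_S = card_pos_sols[of "sg i 1 * b1" "sg j 2 * c2" "sg i 2 * c1" "sg j 1 * b2" "sg j 0 * a2" "sg i 0 * a1"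
    for i j]
  \<comment> \<open>For \<open>i = j\<close> the entries are those of the cross product of the
    points up to sign; for \<open>i \<noteq> j\<close> some entry is a sum of two positive products
    up to sign.\<close>
  have indep: "(sg i 1 * b1) * (sg j 2 * c2) - (sg i 2 * c1) * (sg j 1 * b2) \<noteq> 0
     \<or> (sg i 2 * c1) * (sg j 0 * a2) - (sg i 0 * a1) * (sg j 2 * c2) \<noteq> 0
     \<or> (sg i 0 * a1) * (sg j 1 * b2) - (sg i 1 * b1) * (sg j 0 * a2) \<noteq> 0" if "i < 3" "j < 3" for i j
    using three[OF that(1)] three[OF that(2)] prods nz by (auto simp: sg_def)
  have fin: "finite (S (i, j))" if "i < 3" "j < 3" for i j
    using card_S(1)[OF indep[OF that]] by (simp add: S_def)
  have card: "card (S (i, j)) = of_bool (same_sign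
       ((sg i 1 * b1) * (sg j 2 * c2) - (sg i 2 * c1) * (sg j 1 * b2))
       ((sg i 2 * c1) * (sg j 0 * a2) - (sg i 0 * a1) * (sg j 2 * c2))
       ((sg i 0 * a1) * (sg j 1 * b2) - (sg i 1 * b1) * (sg j 0 * a2)))" if "i < 3" "j < 3" for i j
    using card_S(2)[OF indep[OF that]] by (simp add: S_def)
  \<comment> \<open>For \<open>i \<noteq> j\<close> two entries are sums of positive products with a
    common sign, so the remaining entry, one of \<open>u\<close>, \<open>v\<close>,
    \<open>w\<close>, decides; \<open>(i, j)\<close> and \<open>(j, i)\<close> ask for opposite
    signs of it. For \<open>i = j\<close> two of \<open>u\<close>, \<open>v\<close>,
    \<open>w\<close> change sign.\<close>
  have c: "card (S (0, 0)) = of_bool (same_sign u (- v) (- w))"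
    "card (S (1, 1)) = of_bool (same_sign (- u) v (- w))"
    "card (S (2, 2)) = of_bool (same_sign (- u) (- v) w)"
    "card (S (0, 1)) = of_bool (0 < w)" "card (S (1, 0)) = of_bool (w < 0)"
    "card (S (1, 2)) = of_bool (0 < u)" "card (S (2, 1)) = of_bool (u < 0)"
    "card (S (2, 0)) = of_bool (0 < v)" "card (S (0, 2)) = of_bool (v < 0)"
    using prods by (simp_all add: card sg_def same_sign_def u_def v_def w_def)
  have three_sum: "(\<Sum>i<3. g i) = g 0 + g 1 + g 2" for g :: "nat \<Rightarrow> nat"
    by (simp add: numeral_3_eq_3 numeral_2_eq_2)
  have sgn_split: "of_bool (t \<noteq> 0) = (of_bool (0 < t) + of_bool (t < 0) :: nat)" for t :: real
    by (cases t "0::real" rule: linorder_cases) simp_all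
  have "card (inconic_params a1 b1 c1 a2 b2 c2) = (\<Sum>i<3. \<Sum>j<3. card (S (i, j)))"
    unfolding S_def by (rule card_inconic_params_eq_sum[OF pos]) (use fin in \<open>simp add: S_def\<close>)
  also have "\<dots> = of_bool (same_sign u (- v) (- w)) + of_bool (same_sign (- u) v (- w))
      + of_bool (same_sign (- u) (- v) w) + of_bool (u \<noteq> 0) + of_bool (v \<noteq> 0) + of_bool (w \<noteq> 0)"
    unfolding three_sum c sgn_split by simp
  also have "\<dots> = (if u = 0 \<or> v = 0 \<or> w = 0 then 2 else 4)"
  proof -
    \<comment> \<open>By \<open>rel\<close> the entries cannot share one sign. If none vanishes,
      exactly one differs in sign from the other two, and exactly one equal-type system is
      solvable.\<close>
    have "\<not> (0 < u \<and> 0 < v \<and> 0 < w)" "\<not> (u < 0 \<and> v < 0 \<and> w < 0)"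
      using rel pos mult_pos_pos[of a1 u] mult_pos_pos[of b1 v] mult_pos_pos[of c1 w]
        mult_pos_neg[of a1 u] mult_pos_neg[of b1 v] mult_pos_neg[of c1 w] by linarith+
    \<comment> \<open>Two vanishing entries would force the third to vanish by \<open>rel\<close>,
      against \<open>nz\<close>.\<close>
    moreover have "\<not> (u = 0 \<and> v = 0)" "\<not> (u = 0 \<and> w = 0)" "\<not> (v = 0 \<and> w = 0)"
      using rel pos nz by (auto simp: u_def v_def w_def)
    ultimately show ?thesis
      by (rule_tac linorder_cases[of u 0]; rule_tac linorder_cases[of v 0];
          rule_tac linorder_cases[of w 0]; simp add: same_sign_def)
  qed
  finally show ?thesis by (simp add: u_def v_def w_def)
qed

section \<open>Barycentric coordinates\<close>

locale triangle =
  fixes A B C :: "real^2"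
  assumes nondegenerate: "cr (A - C) (B - C) \<noteq> 0"
begin

text \<open>The capital functions act on displacement vectors and sum to zero. They are the linear
  parts of the barycentric coordinates \<open>x\<close>, \<open>y\<close>, \<open>z\<close> of
  points, computed by Cramer's rule in the basis \<open>A - C\<close>, \<open>B - C\<close>.\<close>

definition X where "X u = cr u (B - C) / cr (A - C) (B - C)"
definition Y where "Y u = cr (A - C) u / cr (A - C) (B - C)"
definition Z where "Z u = - X u - Y u"
definition x where "x p = X (p - C)"
definition y where "y p = Y (p - C)"
definition z where "z p = 1 - x p - y p"

lemma linear_XYZ:
  "X (u + v) = X u + X v" "X (u - v) = X u - X v" "X (k *\<^sub>R u) = k * X u"
  "Y (u + v) = Y u + Y v" "Y (u - v) = Y u - Y v" "Y (k *\<^sub>R u) = k * Y u"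
  "Z (u + v) = Z u + Z v" "Z (u - v) = Z u - Z v" "Z (k *\<^sub>R u) = k * Z u"
proof -
  show X: "X (u + v) = X u + X v" "X (u - v) = X u - X v" "X (k *\<^sub>R u) = k * X u" for u v k
    unfolding X_def cr_add(1) cr_diff(1)[of u v] cr_scale(1)
    by (rule add_divide_distrib diff_divide_distrib times_divide_eq_right[symmetric])+
  show Y: "Y (u + v) = Y u + Y v" "Y (u - v) = Y u - Y v" "Y (k *\<^sub>R u) = k * Y u" for u v k
    unfolding Y_def cr_add(2) cr_diff(2)[of _ u v] cr_scale(2)
    by (rule add_divide_distrib diff_divide_distrib times_divide_eq_right[symmetric])+
  show "Z (u + v) = Z u + Z v" "Z (u - v) = Z u - Z v" "Z (k *\<^sub>R u) = k * Z u"
    unfolding Z_def X Y by (simp_all add: algebra_simps)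
qed

lemma XY_basis: "X (A - C) = 1" "X (B - C) = 0" "Y (A - C) = 0" "Y (B - C) = 1"
  using nondegenerate by (simp_all add: X_def Y_def)

lemma XY_expand: "u = X u *\<^sub>R (A - C) + Y u *\<^sub>R (B - C)"
  unfolding X_def Y_def using cr_basis[OF nondegenerate] .

lemma cr_XY: "cr u v = (X u * Y v - X v * Y u) * cr (A - C) (B - C)"
proof -
  have "cr u v = cr (X u *\<^sub>R (A - C) + Y u *\<^sub>R (B - C)) (X v *\<^sub>R (A - C) + Y v *\<^sub>R (B - C))"
    by (rule arg_cong2[where f = cr]) (rule XY_expand)+
  also have "\<dots> = (X u * Y v - X v * Y u) * cr (A - C) (B - C)"
    unfolding cr_add cr_scale cr_self cr_swap[of "B - C" "A - C"] by (simp add: algebra_simps)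
  finally show ?thesis .
qed

lemma xyz_affine:
  "x (c + a *\<^sub>R u + b *\<^sub>R v) = x c + a * X u + b * X v"
  "y (c + a *\<^sub>R u + b *\<^sub>R v) = y c + a * Y u + b * Y v"
  "z (c + a *\<^sub>R u + b *\<^sub>R v) = z c + a * Z u + b * Z v"
proof -
  have "c + a *\<^sub>R u + b *\<^sub>R v - C = (c - C) + a *\<^sub>R u + b *\<^sub>R v" by simp
  then show "x (c + a *\<^sub>R u + b *\<^sub>R v) = x c + a * X u + b * X v"
    and "y (c + a *\<^sub>R u + b *\<^sub>R v) = y c + a * Y u + b * Y v"
    unfolding x_def y_def by (simp_all add: linear_XYZ)
  then show "z (c + a *\<^sub>R u + b *\<^sub>R v) = z c + a * Z u + b * Z v"
    by (simp add: z_def Z_def algebra_simps)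
qed

lemma xyz_sum: "x p + y p + z p = 1"
  by (simp add: z_def)

lemma xyz_comb:
  assumes "a + b + c = 1"
  shows "x (a *\<^sub>R A + b *\<^sub>R B + c *\<^sub>R C) = a" "y (a *\<^sub>R A + b *\<^sub>R B + c *\<^sub>R C) = b"
    "z (a *\<^sub>R A + b *\<^sub>R B + c *\<^sub>R C) = c"
proof -
  have c: "c = 1 - a - b" using assms by simp
  have *: "a *\<^sub>R A + b *\<^sub>R B + c *\<^sub>R C - C = a *\<^sub>R (A - C) + b *\<^sub>R (B - C)"
    unfolding c by (simp add: algebra_simps)
  show "x (a *\<^sub>R A + b *\<^sub>R B + c *\<^sub>R C) = a" "y (a *\<^sub>R A + b *\<^sub>R B + c *\<^sub>R C) = b"
    unfolding x_def y_def * linear_XYZ(1,3,4,6) XY_basis by simp_all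
  then show "z (a *\<^sub>R A + b *\<^sub>R B + c *\<^sub>R C) = c" by (simp add: z_def c)
qed

lemma xyz_expand: "p = x p *\<^sub>R A + y p *\<^sub>R B + z p *\<^sub>R C"
proof -
  have "p - C = x p *\<^sub>R (A - C) + y p *\<^sub>R (B - C)" unfolding x_def y_def by (rule XY_expand)
  then show ?thesis unfolding z_def by (simp add: algebra_simps)
qed

lemma xyz_eqI: "x p = x q \<Longrightarrow> y p = y q \<Longrightarrow> p = q"
  using xyz_expand[of p] xyz_expand[of q] by (metis z_def)

lemma mem_hull: "p \<in> convex hull {A, B, C} \<longleftrightarrow> 0 \<le> x p \<and> 0 \<le> y p \<and> 0 \<le> z p"
proof
  assume "p \<in> convex hull {A, B, C}"
  then show "0 \<le> x p \<and> 0 \<le> y p \<and> 0 \<le> z p"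
    unfolding convex_hull_3 using xyz_comb by force
next
  assume "0 \<le> x p \<and> 0 \<le> y p \<and> 0 \<le> z p"
  then show "p \<in> convex hull {A, B, C}"
    unfolding convex_hull_3 using xyz_expand[of p] xyz_sum[of p] by blast
qed

lemma mem_interior_hull:
  assumes "p \<in> interior (convex hull {A, B, C})"
  shows "0 < x p" "0 < y p" "0 < z p"
proof -
  have "\<not> collinear {A, B, C}" unfolding collinear_iff_cr by (rule nondegenerate)
  then have "\<exists>a b c. 0 < a \<and> 0 < b \<and> 0 < c \<and> a + b + c = 1 \<and> a *\<^sub>R A + b *\<^sub>R B + c *\<^sub>R C = p"
    using assms interior_convex_hull_3_minimal[of A B C] by auto
  then show "0 < x p" "0 < y p" "0 < z p" using xyz_comb by auto
qed

section \<open>Inscribed ellipses are the conics with positive weights\<close>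

definition conic where "conic l m n = {p. Q l m n (x p) (y p) (z p) = 0}"

lemma conic_scale: "k \<noteq> 0 \<Longrightarrow> conic (k * l) (k * m) (k * n) = conic l m n"
  by (simp add: conic_def Q_scale)

text \<open>By \<open>Q_on_ellipse\<close> the form at the parameter \<open>(a, b)\<close> is a
  non-zero multiple of \<open>a\<^sup>2 + b\<^sup>2 - 1\<close>, and every point of the plane has
  such a parameter because \<open>u\<close> and \<open>v\<close> form a basis.\<close>

lemma ellipse_eq_conic:
  assumes uv: "cr u v \<noteq> 0"
    and n: "(X u)\<^sup>2 + (X v)\<^sup>2 = (x c)\<^sup>2" "(Y u)\<^sup>2 + (Y v)\<^sup>2 = (y c)\<^sup>2" "(Z u)\<^sup>2 + (Z v)\<^sup>2 = (z c)\<^sup>2"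
  shows "ellipse_param c u v = conic (1 - 2 * x c) (1 - 2 * y c) (1 - 2 * z c)"
    and "(1 - 2 * x c) * (1 - 2 * y c) * (1 - 2 * z c) \<noteq> 0"
proof -
  define \<delta> where "\<delta> = X u * Y v - X v * Y u"
  have \<delta>: "\<delta> \<noteq> 0" using uv cr_XY[of u v] by (auto simp: \<delta>_def)
  have s: "X u + Y u + Z u = 0" "X v + Y v + Z v = 0" by (simp_all add: Z_def)
  note q = Q_on_ellipse[OF xyz_sum s n, folded \<delta>_def]
  show "(1 - 2 * x c) * (1 - 2 * y c) * (1 - 2 * z c) \<noteq> 0" using q(1) \<delta> by simp
  have on: "c + a *\<^sub>R u + b *\<^sub>R v \<in> conic (1 - 2 * x c) (1 - 2 * y c) (1 - 2 * z c) \<longleftrightarrow> a\<^sup>2 + b\<^sup>2 = 1" for a b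
    unfolding conic_def mem_Collect_eq xyz_affine q(2) using \<delta> by simp
  show "ellipse_param c u v = conic (1 - 2 * x c) (1 - 2 * y c) (1 - 2 * z c)"
  proof (intro set_eqI iffI)
    fix p assume "p \<in> ellipse_param c u v"
    then show "p \<in> conic (1 - 2 * x c) (1 - 2 * y c) (1 - 2 * z c)"
      using on by (auto simp: ellipse_param_def)
  next
    fix p assume p: "p \<in> conic (1 - 2 * x c) (1 - 2 * y c) (1 - 2 * z c)"
    obtain a b where "p - c = a *\<^sub>R u + b *\<^sub>R v" using cr_basis[OF uv] by blast
    then have "p = c + a *\<^sub>R u + b *\<^sub>R v" by (simp add: algebra_simps)
    with p on show "p \<in> ellipse_param c u v" unfolding ellipse_param_def by blast
  qed
qed

lemma side_zero:
  "p \<in> closed_segment A B \<Longrightarrow> z p = 0" "p \<in> closed_segment B C \<Longrightarrow> x p = 0"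
  "p \<in> closed_segment C A \<Longrightarrow> y p = 0"
proof -
  show "z p = 0" if "p \<in> closed_segment A B"
    using that xyz_comb(3)[of "1 - t" t 0 for t] unfolding closed_segment_def
    by (elim CollectE exE conjE) simp
  show "x p = 0" if "p \<in> closed_segment B C"
    using that xyz_comb(1)[of 0 "1 - t" t for t] unfolding closed_segment_def
    by (elim CollectE exE conjE) simp
  show "y p = 0" if "p \<in> closed_segment C A"
    using that xyz_comb(2)[of t 0 "1 - t" for t] unfolding closed_segment_def
    by (elim CollectE exE conjE) (simp add: add.commute)
qed

lemma comb_mem_conic:
  "a + b + c = 1 \<Longrightarrow> a *\<^sub>R A + b *\<^sub>R B + c *\<^sub>R C \<in> conic l m n \<longleftrightarrow> Q l m n a b c = 0"
  unfolding conic_def by (simp only: xyz_comb mem_Collect_eq)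

text \<open>On the ellipse each barycentric coordinate is a non-negative affine function of the unit
  circle with a zero at the point of contact, so \<open>unit_circle_tangent\<close> supplies the
  hypotheses of \<open>ellipse_eq_conic\<close>.\<close>

lemma inscribed_imp_conic:
  assumes "inscribed_ellipse A B C E"
  obtains l m n where "0 < l" "0 < m" "0 < n" "E = conic l m n"
proof -
  obtain c u v where uv: "cr u v \<noteq> 0" and E: "E = ellipse_param c u v"
    using assms unfolding inscribed_ellipse_def is_ellipse_iff by blast
  have pos: "0 \<le> x c + a * X u + b * X v" "0 \<le> y c + a * Y u + b * Y v"
    "0 \<le> z c + a * Z u + b * Z v" if "a\<^sup>2 + b\<^sup>2 = 1" for a b
  proof -
    have "c + a *\<^sub>R u + b *\<^sub>R v \<in> E" using that by (auto simp: E ellipse_param_def)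
    then have "c + a *\<^sub>R u + b *\<^sub>R v \<in> convex hull {A, B, C}"
      using assms unfolding inscribed_ellipse_def by blast
    then show "0 \<le> x c + a * X u + b * X v" "0 \<le> y c + a * Y u + b * Y v"
    "0 \<le> z c + a * Z u + b * Z v" unfolding mem_hull xyz_affine by auto
  qed
  have touch: "\<exists>a b. a\<^sup>2 + b\<^sup>2 = 1 \<and> c + a *\<^sub>R u + b *\<^sub>R v \<in> closed_segment P R"
    if "tangent_to_side E P R" for P R
  proof -
    from that obtain p where "p \<in> closed_segment P R" "p \<in> E"
      unfolding tangent_to_side_def tangent_line_at_def by metis
    then show ?thesis unfolding E ellipse_param_def by blast
  qed
  obtain a1 b1 where 1: "a1\<^sup>2 + b1\<^sup>2 = 1" "x c + a1 * X u + b1 * X v = 0"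
    using touch[of B C] side_zero(2) assms unfolding inscribed_ellipse_def xyz_affine[symmetric] by blast
  obtain a2 b2 where 2: "a2\<^sup>2 + b2\<^sup>2 = 1" "y c + a2 * Y u + b2 * Y v = 0"
    using touch[of C A] side_zero(3) assms unfolding inscribed_ellipse_def xyz_affine[symmetric] by blast
  obtain a3 b3 where 3: "a3\<^sup>2 + b3\<^sup>2 = 1" "z c + a3 * Z u + b3 * Z v = 0"
    using touch[of A B] side_zero(1) assms unfolding inscribed_ellipse_def xyz_affine[symmetric] by blast
  note t1 = unit_circle_tangent[OF pos(1) 1] and t2 = unit_circle_tangent[OF pos(2) 2]
    and t3 = unit_circle_tangent[OF pos(3) 3]
  note eq = ellipse_eq_conic[OF uv t1(2) t2(2) t3(2)]
  have s: "X u + Y u + Z u = 0" "X v + Y v + Z v = 0" by (simp_all add: Z_def)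
  have s': "Y u + Z u + X u = 0" "Y v + Z v + X v = 0" "Z u + X u + Y u = 0" "Z v + X v + Y v = 0"
    by (simp_all add: Z_def)
  have "x c \<le> y c + z c" by (rule norm_triangle_if_sum_zero[OF s t1(1) t2(1) t3(1) t1(2) t2(2) t3(2)])
  moreover have "y c \<le> z c + x c"
    by (rule norm_triangle_if_sum_zero[OF s'(1,2) t2(1) t3(1) t1(1) t2(2) t3(2) t1(2)])
  moreover have "z c \<le> x c + y c"
    by (rule norm_triangle_if_sum_zero[OF s'(3,4) t3(1) t1(1) t2(1) t3(2) t1(2) t2(2)])
  moreover have "x c + y c + z c = 1" by (rule xyz_sum)
  \<comment> \<open>As the coordinates of the centre sum to 1, the triangle inequalities say that
    the weights are non-negative; their non-zero product then makes them positive.\<close>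
  ultimately have "0 \<le> 1 - 2 * x c" "0 \<le> 1 - 2 * y c" "0 \<le> 1 - 2 * z c" by linarith+
  then have "0 < 1 - 2 * x c" "0 < 1 - 2 * y c" "0 < 1 - 2 * z c"
    using eq(2) by (auto simp: less_le)
  then show ?thesis using that eq(1) E by blast
qed

lemma conic_subset_hull:
  assumes "0 < l" "0 < m" "0 < n"
  shows "conic l m n \<subseteq> convex hull {A, B, C}"
  using Q_zero_nonneg[OF assms xyz_sum] by (auto simp: conic_def mem_hull)

text \<open>On the side \<open>A B\<close> the form restricts to the square of
  \<open>l * x - m * y\<close>, so the contact point has coordinates in the ratio
  \<open>m : l\<close>; the other sides are analogous.\<close>

lemma conic_touch:
  assumes "0 < l" "0 < m" "0 < n"
  shows "\<exists>p \<in> closed_segment A B. p \<in> conic l m n"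
    and "\<exists>p \<in> closed_segment B C. p \<in> conic l m n"
    and "\<exists>p \<in> closed_segment C A. p \<in> conic l m n"
proof -
  have div: "1 - b / (a + b) = a / (a + b)" "a / (a + b) + b / (a + b) = 1"
    if "0 < a" "0 < b" for a b :: real
    using that by (simp_all add: diff_eq_eq flip: add_divide_distrib)
  have z: "Q l m n (m / (m + l)) (l / (m + l)) 0 = 0"
     "Q l m n 0 (n / (n + m)) (m / (n + m)) = 0"
     "Q l m n (n / (l + n)) 0 (l / (l + n)) = 0"
    by (simp_all add: Q_def power2_eq_square)
  have seg: "(a / (a + b)) *\<^sub>R P + (b / (a + b)) *\<^sub>R R \<in> closed_segment P R"
    if "0 < a" "0 < b" for a b and P R :: "real^2"
    unfolding closed_segment_def mem_Collect_eq
    by (rule exI[of _ "b / (a + b)"]) (use that div(1)[OF that] in simp)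
  show "\<exists>p \<in> closed_segment A B. p \<in> conic l m n"
    using seg[of m l A B] comb_mem_conic[of "m / (m + l)" "l / (m + l)" 0 l m n] z(1) div(2)[of m l] assms
    by auto
  show "\<exists>p \<in> closed_segment B C. p \<in> conic l m n"
    using seg[of n m B C] comb_mem_conic[of 0 "n / (n + m)" "m / (n + m)" l m n] z(2) div(2)[of n m] assms
    by auto
  show "\<exists>p \<in> closed_segment C A. p \<in> conic l m n"
    using seg[of l n C A] comb_mem_conic[of "n / (l + n)" 0 "l / (l + n)" l m n] z(3) div(2)[of l n] assms
    by (auto simp: add.commute)
qed

text \<open>Centre and conjugate semi-diameters are recovered from the weights by inverting the
  relations in \<open>Q_on_ellipse\<close>.\<close>

lemma conic_is_ellipse:
  assumes pos: "0 < l" "0 < m" "0 < n" and sum: "l + m + n = 1"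
  obtains c u v where "cr u v \<noteq> 0" "conic l m n = ellipse_param c u v"
proof -
  \<comment> \<open>The centre solves \<open>l = 1 - 2 * r1\<close> and its analogues.\<close>
  define r1 r2 r3 where "r1 = (m + n) / 2" and "r2 = (l + n) / 2" and "r3 = (l + m) / 2"
  \<comment> \<open>A rotation of the parameter allows \<open>d2 = 0\<close> and
    \<open>e2 = r2\<close>. Then the determinant is \<open>d1 * r2\<close>, with four times its
    square equal to \<open>l * m * n\<close>, and the inner product is \<open>e1 * r2\<close>, equal
    to \<open>(l * m - n) / 4\<close>.\<close>
  define d1 e1 where "d1 = sqrt (l * m * n) / (2 * r2)" and "e1 = - (n - l * m) / (4 * r2)"
  have r: "r1 + r2 + r3 = 1" using sum by (simp add: r1_def r2_def r3_def field_simps)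
  have lmn: "l = 1 - 2 * r1" "m = 1 - 2 * r2" "n = 1 - 2 * r3"
    using sum by (simp_all add: r1_def r2_def r3_def field_simps)
  have r3: "r3 = 1 - r1 - r2" using r by linarith
  have r2: "r2 > 0" using pos by (simp add: r2_def)
  define c where "c = r1 *\<^sub>R A + r2 *\<^sub>R B + r3 *\<^sub>R C"
  define u where "u = d1 *\<^sub>R (A - C)"
  define v where "v = e1 *\<^sub>R (A - C) + r2 *\<^sub>R (B - C)"
  have c: "x c = r1" "y c = r2" "z c = r3" unfolding c_def using xyz_comb[OF r] by auto
  have XY: "X u = d1" "Y u = 0" "Z u = - d1" "X v = e1" "Y v = r2" "Z v = - e1 - r2"
    unfolding u_def v_def Z_def linear_XYZ(1,3,4,6) XY_basis by simp_all
  have d1: "d1 > 0" using r2 pos by (simp add: d1_def)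
  have uv: "cr u v \<noteq> 0" unfolding cr_XY[of u v] XY using d1 r2 nondegenerate by simp
  have fac: "4 * l * m * n + (n - l * m)\<^sup>2 = (4 * r1 * r2)\<^sup>2"
  proof -
    have "4 * r1 * r2 = l * m + n * (l + m + n)"
      by (simp add: r1_def r2_def field_simps)
    then have "4 * r1 * r2 = l * m + n" unfolding sum by simp
    then show ?thesis by (simp only:) (simp add: power2_eq_square algebra_simps)
  qed
  have "d1\<^sup>2 = 4 * l * m * n / (4 * r2)\<^sup>2" "e1\<^sup>2 = (n - l * m)\<^sup>2 / (4 * r2)\<^sup>2"
    using pos by (simp_all add: d1_def e1_def power_divide power_mult_distrib power2_commute)
  then have "d1\<^sup>2 + e1\<^sup>2 = (4 * l * m * n + (n - l * m)\<^sup>2) / (4 * r2)\<^sup>2"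
    by (simp add: add_divide_distrib)
  also have "\<dots> = r1\<^sup>2" unfolding fac using r2 by (simp add: power_mult_distrib)
  finally have n1: "d1\<^sup>2 + e1\<^sup>2 = r1\<^sup>2" .
  have e1: "2 * (e1 * r2) = (l * m - n) / 2" using r2 by (simp add: e1_def)
  have "(- d1)\<^sup>2 + (- e1 - r2)\<^sup>2 = (d1\<^sup>2 + e1\<^sup>2) + r2\<^sup>2 + 2 * (e1 * r2)"
    by (simp add: power2_eq_square algebra_simps)
  also have "\<dots> = r3\<^sup>2" unfolding n1 e1 lmn r3 by (simp add: power2_eq_square field_simps)
  finally have n3: "(- d1)\<^sup>2 + (- e1 - r2)\<^sup>2 = r3\<^sup>2" .
  have "ellipse_param c u v = conic l m n"
    unfolding lmn using ellipse_eq_conic(1)[OF uv, of c] n1 n3 unfolding XY c by simp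
  then show ?thesis using that uv by metis
qed

text \<open>At a contact point one barycentric coordinate attains its minimum 0 on the ellipse, so
  its linear part annihilates the velocity \<open>a *\<^sub>R v - b *\<^sub>R u\<close>, which is
  therefore parallel to the side.\<close>

lemma conic_inscribed:
  assumes pos: "0 < l" "0 < m" "0 < n"
  shows "inscribed_ellipse A B C (conic l m n)"
proof -
  define k where "k = 1 / (l + m + n)"
  have k: "k > 0" using pos by (simp add: k_def)
  have "k * l + k * m + k * n = k * (l + m + n)" by (simp add: algebra_simps)
  also have "\<dots> = 1" using pos by (simp add: k_def)
  finally obtain c u v where uv: "cr u v \<noteq> 0"
    and "conic (k * l) (k * m) (k * n) = ellipse_param c u v"
    using conic_is_ellipse[of "k * l" "k * m" "k * n"] pos k by (metis mult_pos_pos)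
  then have E: "conic l m n = ellipse_param c u v" using conic_scale k by simp
  have nonneg: "0 \<le> x c + a * X u + b * X v" "0 \<le> y c + a * Y u + b * Y v"
    "0 \<le> z c + a * Z u + b * Z v" if "a\<^sup>2 + b\<^sup>2 = 1" for a b
  proof -
    have "c + a *\<^sub>R u + b *\<^sub>R v \<in> conic l m n" using that by (auto simp: E ellipse_param_def)
    then have "c + a *\<^sub>R u + b *\<^sub>R v \<in> convex hull {A, B, C}"
      using conic_subset_hull[OF pos] by blast
    then show "0 \<le> x c + a * X u + b * X v" "0 \<le> y c + a * Y u + b * Y v"
    "0 \<le> z c + a * Z u + b * Z v" unfolding mem_hull xyz_affine by auto
  qed
  have pt: "\<exists>a b. a\<^sup>2 + b\<^sup>2 = 1 \<and> p = c + a *\<^sub>R u + b *\<^sub>R v" if "p \<in> conic l m n" for p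
    using that unfolding E ellipse_param_def by blast
  have "tangent_to_side (conic l m n) A B"
  proof -
    obtain a b where ab: "a\<^sup>2 + b\<^sup>2 = 1" and p: "c + a *\<^sub>R u + b *\<^sub>R v \<in> closed_segment A B"
      using conic_touch(1)[OF pos] pt by blast
    from side_zero(1)[OF p] have "a * Z v - b * Z u = 0"
      using unit_circle_tangent(3)[OF nonneg(3) ab] unfolding xyz_affine by blast
    then have "Z (a *\<^sub>R v - b *\<^sub>R u) = 0" by (simp add: linear_XYZ)
    then have "Y (a *\<^sub>R v - b *\<^sub>R u) = - X (a *\<^sub>R v - b *\<^sub>R u)" by (simp add: Z_def)
    then have "a *\<^sub>R v - b *\<^sub>R u = (- X (a *\<^sub>R v - b *\<^sub>R u)) *\<^sub>R (B - A)"
      using XY_expand[of "a *\<^sub>R v - b *\<^sub>R u"] by (simp add: algebra_simps)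
    then show ?thesis unfolding E by (rule tangent_to_sideI[OF uv ab p])
  qed
  moreover have "tangent_to_side (conic l m n) B C"
  proof -
    obtain a b where ab: "a\<^sup>2 + b\<^sup>2 = 1" and p: "c + a *\<^sub>R u + b *\<^sub>R v \<in> closed_segment B C"
      using conic_touch(2)[OF pos] pt by blast
    from side_zero(2)[OF p] have "a * X v - b * X u = 0"
      using unit_circle_tangent(3)[OF nonneg(1) ab] unfolding xyz_affine by blast
    then have "X (a *\<^sub>R v - b *\<^sub>R u) = 0" by (simp add: linear_XYZ)
    then have "a *\<^sub>R v - b *\<^sub>R u = (- Y (a *\<^sub>R v - b *\<^sub>R u)) *\<^sub>R (C - B)"
      using XY_expand[of "a *\<^sub>R v - b *\<^sub>R u"] by (simp add: algebra_simps)
    then show ?thesis unfolding E by (rule tangent_to_sideI[OF uv ab p])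
  qed
  moreover have "tangent_to_side (conic l m n) C A"
  proof -
    obtain a b where ab: "a\<^sup>2 + b\<^sup>2 = 1" and p: "c + a *\<^sub>R u + b *\<^sub>R v \<in> closed_segment C A"
      using conic_touch(3)[OF pos] pt by blast
    from side_zero(3)[OF p] have "a * Y v - b * Y u = 0"
      using unit_circle_tangent(3)[OF nonneg(2) ab] unfolding xyz_affine by blast
    then have "Y (a *\<^sub>R v - b *\<^sub>R u) = 0" by (simp add: linear_XYZ)
    then have "a *\<^sub>R v - b *\<^sub>R u = X (a *\<^sub>R v - b *\<^sub>R u) *\<^sub>R (A - C)"
      using XY_expand[of "a *\<^sub>R v - b *\<^sub>R u"] by simp
    then show ?thesis unfolding E by (rule tangent_to_sideI[OF uv ab p])
  qed
  moreover have "is_ellipse (conic l m n)" unfolding E is_ellipse_iff using uv by blast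
  ultimately show ?thesis
    unfolding inscribed_ellipse_def using conic_subset_hull[OF pos] by blast
qed


section \<open>Uniqueness of the weights up to scaling\<close>

lemma Q_side: "Q l m n a b 0 = (l * a - m * b)\<^sup>2" "Q l m n 0 a b = (m * a - n * b)\<^sup>2"
  by (simp_all add: Q_def power2_eq_square algebra_simps)

text \<open>The contact points of the first conic with \<open>A B\<close> and \<open>B C\<close> lie
  on the second, whose form is a perfect square on each side; its vanishing compares the ratios of
  the weights.\<close>

lemma conic_eq_imp_proportional:
  assumes "0 < l" "0 < m" "0 < n" and eq: "conic l m n = conic l' m' n'"
  shows "l' * m = m' * l" "m' * n = n' * m"
proof -
  have *: "b / (a + b) + a / (a + b) = 1" if "0 < a" "0 < b" for a b :: real
    using that by (simp add: add.commute flip: add_divide_distrib)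
  have mem: "(m / (l + m)) *\<^sub>R A + (l / (l + m)) *\<^sub>R B + 0 *\<^sub>R C \<in> conic l'' m'' n'' \<longleftrightarrow> l'' * m = m'' * l"
    "0 *\<^sub>R A + (n / (m + n)) *\<^sub>R B + (m / (m + n)) *\<^sub>R C \<in> conic l'' m'' n'' \<longleftrightarrow> m'' * n = n'' * m"
    for l'' m'' n''
    using comb_mem_conic[of "m / (l + m)" "l / (l + m)" 0 l'' m'' n'']
      comb_mem_conic[of 0 "n / (m + n)" "m / (m + n)" l'' m'' n''] *[of l m] *[of m n] assms(1-3)
    by (simp_all add: Q_side)
  show "l' * m = m' * l" "m' * n = n' * m"
    using mem eq by (metis mult.commute)+
qed

section \<open>Lines through a vertex\<close>

lemma mem_line_iff:
  "p \<in> affine hull {P1, P2} \<longleftrightarrow>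
    (\<exists>u. x p = u * x P1 + (1 - u) * x P2 \<and> y p = u * y P1 + (1 - u) * y P2
      \<and> z p = u * z P1 + (1 - u) * z P2)"
proof -
  have "x (u *\<^sub>R P1 + (1 - u) *\<^sub>R P2) = u * x P1 + (1 - u) * x P2"
    "y (u *\<^sub>R P1 + (1 - u) *\<^sub>R P2) = u * y P1 + (1 - u) * y P2"
    "z (u *\<^sub>R P1 + (1 - u) *\<^sub>R P2) = u * z P1 + (1 - u) * z P2" for u
  proof -
    \<comment> \<open>The dummy term brings the point into the shape of
      \<open>xyz_affine\<close>.\<close>
    have *: "u *\<^sub>R P1 + (1 - u) *\<^sub>R P2 = P2 + u *\<^sub>R (P1 - P2) + 0 *\<^sub>R 0"
      by (simp add: algebra_simps)
    have XY: "X (P1 - P2) = x P1 - x P2" "Y (P1 - P2) = y P1 - y P2"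
      unfolding x_def y_def linear_XYZ(2,5) by simp_all
    then have Z: "Z (P1 - P2) = z P1 - z P2" unfolding Z_def z_def by simp
    show "x (u *\<^sub>R P1 + (1 - u) *\<^sub>R P2) = u * x P1 + (1 - u) * x P2"
      "y (u *\<^sub>R P1 + (1 - u) *\<^sub>R P2) = u * y P1 + (1 - u) * y P2"
      "z (u *\<^sub>R P1 + (1 - u) *\<^sub>R P2) = u * z P1 + (1 - u) * z P2"
      unfolding * xyz_affine XY Z by (simp_all add: algebra_simps)
  qed
  moreover have "p \<in> affine hull {P1, P2} \<longleftrightarrow> (\<exists>u. p = u *\<^sub>R P1 + (1 - u) *\<^sub>R P2)"
  proof
    assume "p \<in> affine hull {P1, P2}"
    then obtain u v where "p = u *\<^sub>R P1 + v *\<^sub>R P2" "u + v = 1" by (auto simp: affine_hull_2)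
    moreover then have "v = 1 - u" by simp
    ultimately show "\<exists>u. p = u *\<^sub>R P1 + (1 - u) *\<^sub>R P2" by blast
  qed (force simp: affine_hull_2)
  ultimately show ?thesis by (metis xyz_eqI)
qed

text \<open>A vertex is the common zero of two coordinates, so it lies on the line iff the matching
  entry of the cross product of the coordinate triples vanishes.\<close>

lemma vertex_mem_line_iff:
  assumes "P1 \<noteq> P2"
  shows "A \<in> affine hull {P1, P2} \<longleftrightarrow> y P1 * z P2 = z P1 * y P2"
    and "B \<in> affine hull {P1, P2} \<longleftrightarrow> z P1 * x P2 = x P1 * z P2"
    and "C \<in> affine hull {P1, P2} \<longleftrightarrow> x P1 * y P2 = y P1 * x P2"
proof -
  have sum: "x P1 + y P1 + z P1 = 1" "x P2 + y P2 + z P2 = 1" by (rule xyz_sum)+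
  have neq: "\<not> (x P1 = x P2 \<and> y P1 = y P2)" using assms xyz_eqI by blast
  have ABC: "x A = 1" "y A = 0" "z A = 0" "x B = 0" "y B = 1" "z B = 0" "x C = 0" "y C = 0" "z C = 1"
    using xyz_comb[of 1 0 0] xyz_comb[of 0 1 0] xyz_comb[of 0 0 1] by simp_all
  define g where "g f u = u * f P1 + (1 - u) * f P2" for f :: "real^2 \<Rightarrow> real" and u
  have "g x u + g y u + g z u = u * (x P1 + y P1 + z P1) + (1 - u) * (x P2 + y P2 + z P2)" for u
    unfolding g_def by (simp add: algebra_simps)
  then have g1: "g x u + g y u + g z u = 1" for u unfolding sum by simp
  \<comment> \<open>The coordinates sum to 1, so two zeros force the third to be 1.\<close>
  have drop: "1 = g x u \<and> 0 = g y u \<and> 0 = g z u \<longleftrightarrow> 0 = g y u \<and> 0 = g z u"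
    "0 = g x u \<and> 1 = g y u \<and> 0 = g z u \<longleftrightarrow> 0 = g z u \<and> 0 = g x u"
    "0 = g x u \<and> 0 = g y u \<and> 1 = g z u \<longleftrightarrow> 0 = g x u \<and> 0 = g y u" for u
    using g1[of u] by auto
  have neq': "\<not> (y P1 = y P2 \<and> z P1 = z P2)" "\<not> (z P1 = z P2 \<and> x P1 = x P2)"
    using neq sum by linarith+
  show "A \<in> affine hull {P1, P2} \<longleftrightarrow> y P1 * z P2 = z P1 * y P2"
    and "B \<in> affine hull {P1, P2} \<longleftrightarrow> z P1 * x P2 = x P1 * z P2"
    and "C \<in> affine hull {P1, P2} \<longleftrightarrow> x P1 * y P2 = y P1 * x P2"
    unfolding mem_line_iff ABC g_def[symmetric] drop
    unfolding g_def common_zero_iff[OF neq'(1)] common_zero_iff[OF neq'(2)] common_zero_iff[OF neq]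
    by (rule refl)+
qed

section \<open>Counting the inscribed ellipses through two interior points\<close>

text \<open>Squaring the parameters gives the weights of a conic. This is onto because positive
  weights have square roots that can be normalised, and injective because weights are unique up to
  scaling and the sum of the parameters is fixed.\<close>

lemma card_inscribed_through:
  assumes "0 < x P1" "0 < y P1" "0 < z P1" "0 < x P2" "0 < y P2" "0 < z P2"
  shows "card {E. inscribed_ellipse A B C E \<and> P1 \<in> E \<and> P2 \<in> E} =
    card (inconic_params (sqrt (x P1)) (sqrt (y P1)) (sqrt (z P1)) (sqrt (x P2)) (sqrt (y P2)) (sqrt (z P2)))"
    (is "card ?L = card ?S")
proof -
  define f where "f = (\<lambda>(l, m, n). conic (l\<^sup>2) (m\<^sup>2) (n\<^sup>2))"
  have mem: "P1 \<in> conic (l\<^sup>2) (m\<^sup>2) (n\<^sup>2) \<and> P2 \<in> conic (l\<^sup>2) (m\<^sup>2) (n\<^sup>2) \<longleftrightarrow> (l, m, n) \<in> ?S"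
    if "0 < l" "0 < m" "0 < n" "l + m + n = 1" for l m n
    using assms that by (simp add: conic_def inconic_params_def)
  have "?L = f ` ?S"
  proof (intro set_eqI iffI)
    fix E assume "E \<in> ?L"
    then have E: "inscribed_ellipse A B C E" "P1 \<in> E" "P2 \<in> E" by auto
    obtain l m n where pos: "0 < l" "0 < m" "0 < n" and El: "E = conic l m n"
      using inscribed_imp_conic[OF E(1)] .
    \<comment> \<open>Scaling the square roots by \<open>k\<close> to sum 1 scales the weights by
      \<open>k\<^sup>2\<close>, which leaves the conic unchanged.\<close>
    define k where "k = 1 / (sqrt l + sqrt m + sqrt n)"
    have k: "0 < k" using pos by (simp add: k_def add_pos_pos)
    have "k * sqrt l + k * sqrt m + k * sqrt n = k * (sqrt l + sqrt m + sqrt n)"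
      by (simp add: algebra_simps)
    also have "\<dots> = 1" using k unfolding k_def by simp
    finally have one: "k * sqrt l + k * sqrt m + k * sqrt n = 1" .
    have Ef: "E = f (k * sqrt l, k * sqrt m, k * sqrt n)"
      unfolding El f_def using conic_scale[of "k\<^sup>2"] k pos by (simp add: power_mult_distrib)
    with E mem[of "k * sqrt l" "k * sqrt m" "k * sqrt n"] one k pos
    have "(k * sqrt l, k * sqrt m, k * sqrt n) \<in> ?S" by (simp add: f_def)
    then show "E \<in> f ` ?S" using Ef by blast
  next
    fix E assume "E \<in> f ` ?S"
    then obtain l m n where E: "E = conic (l\<^sup>2) (m\<^sup>2) (n\<^sup>2)" and S: "(l, m, n) \<in> ?S"
      by (auto simp: f_def)
    from S have "0 < l" "0 < m" "0 < n" "l + m + n = 1" by (auto simp: inconic_params_def)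
    then show "E \<in> ?L" using mem S conic_inscribed[of "l\<^sup>2" "m\<^sup>2" "n\<^sup>2"] unfolding E by auto
  qed
  moreover have "inj_on f ?S"
  proof (rule inj_onI)
    fix q q' assume q: "q \<in> ?S" "q' \<in> ?S" and eq: "f q = f q'"
    obtain l m n l' m' n' where qq: "q = (l, m, n)" "q' = (l', m', n')" by (metis prod_cases3)
    have p: "0 < l" "0 < m" "0 < n" "l + m + n = 1" "0 < l'" "0 < m'" "0 < n'" "l' + m' + n' = 1"
      using q unfolding qq by (auto simp: inconic_params_def)
    have "l'\<^sup>2 * m\<^sup>2 = m'\<^sup>2 * l\<^sup>2" "m'\<^sup>2 * n\<^sup>2 = n'\<^sup>2 * m\<^sup>2"
      using conic_eq_imp_proportional[of "l\<^sup>2" "m\<^sup>2" "n\<^sup>2" "l'\<^sup>2" "m'\<^sup>2" "n'\<^sup>2"] eq p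
      by (simp_all add: f_def qq)
    then have c: "l' * m = m' * l" "m' * n = n' * m"
      using p by (simp_all flip: power_mult_distrib)
    have "m = m * (l' + m' + n')" using p by simp
    also have "\<dots> = m' * (l + m + n)" using c by (simp add: algebra_simps)
    finally have m: "m = m'" using p by simp
    then show "q = q'" using c p unfolding qq by auto
  qed
  ultimately show ?thesis by (simp add: card_image)
qed

end

theorem theorem1p1:
  fixes A B C P1 P2 :: "real^2"
  assumes "\<not> collinear {A, B, C}"
    and "P1 \<in> interior (convex hull {A, B, C})"
    and "P2 \<in> interior (convex hull {A, B, C})"
    and "P1 \<noteq> P2"
  shows "(A \<notin> affine hull {P1, P2} \<and> B \<notin> affine hull {P1, P2} \<and> C \<notin> affine hull {P1, P2} \<longrightarrow>
            card {E. inscribed_ellipse A B C E \<and> P1 \<in> E \<and> P2 \<in> E} = 4) \<and>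
         (A \<in> affine hull {P1, P2} \<or> B \<in> affine hull {P1, P2} \<or> C \<in> affine hull {P1, P2} \<longrightarrow>
            card {E. inscribed_ellipse A B C E \<and> P1 \<in> E \<and> P2 \<in> E} = 2)"
proof -
  interpret triangle A B C
    using assms(1) by unfold_locales (simp only: collinear_iff_cr not_False_eq_True)
  note pos = mem_interior_hull[OF assms(2)] mem_interior_hull[OF assms(3)]
  note line = vertex_mem_line_iff[OF assms(4)]
  \<comment> \<open>Hence an entry of the cross product vanishes for the square roots iff it does
    for the coordinates themselves.\<close>
  have sqrt_eq: "sqrt a * sqrt b = sqrt c * sqrt d \<longleftrightarrow> a * b = c * d" for a b c d
    by (simp flip: real_sqrt_mult)
  \<comment> \<open>Proportional coordinate triples that both sum to 1 coincide.\<close>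
  have "\<not> (y P1 * z P2 = z P1 * y P2 \<and> z P1 * x P2 = x P1 * z P2 \<and> x P1 * y P2 = y P1 * x P2)"
  proof
    assume *: "y P1 * z P2 = z P1 * y P2 \<and> z P1 * x P2 = x P1 * z P2 \<and> x P1 * y P2 = y P1 * x P2"
    have "x P1 * (x P2 + y P2 + z P2) = x P2 * (x P1 + y P1 + z P1)"
      "y P1 * (x P2 + y P2 + z P2) = y P2 * (x P1 + y P1 + z P1)"
      using * by (simp_all add: algebra_simps)
    then have "P1 = P2" unfolding xyz_sum by (intro xyz_eqI) simp_all
    with assms(4) show False ..
  qed
  then show ?thesis
    unfolding card_inscribed_through[OF pos] line
    using card_inconic_params[of "sqrt (x P1)" "sqrt (y P1)" "sqrt (z P1)"
        "sqrt (x P2)" "sqrt (y P2)" "sqrt (z P2)"] pos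
    by (auto simp: sqrt_eq)
qed

end
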